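(* Let $A$ and $B$ be input types of system $\mathcal F$ not containing the type constant $O$. Then $A\wedge B$, $A\vee B$ and $LA$ are input types.
   Context: $\lambda$-terms are those of the untyped $\lambda$-calculus; normal means without $\beta$-redex. Types of system $\mathcal F$: built from type variables and type constants (atomic, not quantifiable; $O$ is one) with $\rightarrow$, $\forall$; only proper types (in every $\forall XA$, $X$ occurs free in $A$). Typing: (ax) $\Gamma \vdash x_i : A_i$ for $x_i:A_i\in\Gamma$; ($\rightarrow_i$) from $\Gamma, x:B \vdash t : C$ infer $\Gamma \vdash \lambda x t : B \rightarrow C$; ($\rightarrow_e$) from $\Gamma \vdash u : B\rightarrow C$, $\Gamma \vdash v : B$ infer $\Gamma \vdash (u)v : C$; ($\forall_i$) from $\Gamma \vdash t : A$, $X$ not free in $\Gamma$, infer $\Gamma \vdash t : \forall X A$; ($\forall_e$) from $\Gamma \vdash t : \forall X A$ infer $\Gamma \vdash t : A[C/X]$. $\mathcal F_0$ is $\mathcal F$ without ($\forall_e$). An input type is a closed type $E$ such that for every normal $t$, $\vdash_{\mathcal F} t:E$ implies $\vdash_{\mathcal F_0} t:E$. With $X$ a type variable not free in $A,B$: $A\wedge B=\forall X\{(A\rightarrow(B\rightarrow X))\rightarrow X\}$, $A\vee B=\forall X\{(A\rightarrow X)\rightarrow((B\rightarrow X)\rightarrow X)\}$, $LA=\forall X\{X\rightarrow[(A\rightarrow(X\rightarrow X))\rightarrow X]\}$. *)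

theory Defs
  imports Main
begin

datatype lterm = Var nat | Lam nat lterm | App lterm lterm

fun is_lam :: "lterm \<Rightarrow> bool" where
  "is_lam (Lam x t) = True"
| "is_lam _ = False"

fun normal :: "lterm \<Rightarrow> bool" where
  "normal (Var x) = True"
| "normal (Lam x t) = normal t"
| "normal (App t u) = (\<not> is_lam t \<and> normal t \<and> normal u)"

datatype ty = TVar nat | TConst nat | Arr ty ty | All ty

definition TO :: ty where "TO = TConst 0"

fun lift :: "nat \<Rightarrow> ty \<Rightarrow> ty" where
  "lift k (TVar n) = (if n < k then TVar n else TVar (Suc n))"
| "lift k (TConst c) = TConst c"
| "lift k (Arr A B) = Arr (lift k A) (lift k B)"
| "lift k (All A) = All (lift (Suc k) A)"

fun subst :: "nat \<Rightarrow> ty \<Rightarrow> ty \<Rightarrow> ty" where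
  "subst k C (TVar n) = (if n < k then TVar n else if n = k then C else TVar (n - 1))"
| "subst k C (TConst c) = TConst c"
| "subst k C (Arr A B) = Arr (subst k C A) (subst k C B)"
| "subst k C (All A) = All (subst (Suc k) (lift 0 C) A)"

fun fv :: "ty \<Rightarrow> nat set" where
  "fv (TVar n) = {n}"
| "fv (TConst c) = {}"
| "fv (Arr A B) = fv A \<union> fv B"
| "fv (All A) = {n. Suc n \<in> fv A}"

fun tconsts :: "ty \<Rightarrow> nat set" where
  "tconsts (TVar n) = {}"
| "tconsts (TConst c) = {c}"
| "tconsts (Arr A B) = tconsts A \<union> tconsts B"
| "tconsts (All A) = tconsts A"

fun proper :: "ty \<Rightarrow> bool" where
  "proper (TVar n) = True"
| "proper (TConst c) = True"
| "proper (Arr A B) = (proper A \<and> proper B)"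
| "proper (All A) = (proper A \<and> 0 \<in> fv A)"

definition contains_const :: "ty \<Rightarrow> ty \<Rightarrow> bool" where
  "contains_const A K \<longleftrightarrow> (\<exists>c. K = TConst c \<and> c \<in> tconsts A)"

definition closed_ty :: "ty \<Rightarrow> bool" where
  "closed_ty A \<longleftrightarrow> fv A = {}"

section \<open>Typing; flag e = True is system F, e = False is F0 (no forall-elimination)\<close>

type_synonym ctx = "nat \<Rightarrow> ty option"

inductive has_type :: "bool \<Rightarrow> ctx \<Rightarrow> lterm \<Rightarrow> ty \<Rightarrow> bool" where
  ax: "\<Gamma> x = Some A \<Longrightarrow> proper A \<Longrightarrow> has_type e \<Gamma> (Var x) A"
| arr_i: "proper B \<Longrightarrow> has_type e (\<Gamma>(x \<mapsto> B)) t C \<Longrightarrow> has_type e \<Gamma> (Lam x t) (Arr B C)"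
| arr_e: "has_type e \<Gamma> u (Arr B C) \<Longrightarrow> has_type e \<Gamma> v B \<Longrightarrow> has_type e \<Gamma> (App u v) C"
| all_i: "has_type e (map_option (lift 0) \<circ> \<Gamma>) t A \<Longrightarrow> proper (All A) \<Longrightarrow> has_type e \<Gamma> t (All A)"
| all_e: "e \<Longrightarrow> has_type e \<Gamma> t (All A) \<Longrightarrow> proper C \<Longrightarrow> has_type e \<Gamma> t (subst 0 C A)"

definition input_type :: "ty \<Rightarrow> bool" where
  "input_type E \<longleftrightarrow> closed_ty E \<and> proper E \<and>
     (\<forall>t. normal t \<longrightarrow> has_type True Map.empty t E \<longrightarrow> has_type False Map.empty t E)"

definition tconj :: "ty \<Rightarrow> ty \<Rightarrow> ty" where
  "tconj A B = All (Arr (Arr (lift 0 A) (Arr (lift 0 B) (TVar 0))) (TVar 0))"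

definition tdisj :: "ty \<Rightarrow> ty \<Rightarrow> ty" where
  "tdisj A B = All (Arr (Arr (lift 0 A) (TVar 0)) (Arr (Arr (lift 0 B) (TVar 0)) (TVar 0)))"

definition tlist :: "ty \<Rightarrow> ty" where
  "tlist A = All (Arr (TVar 0) (Arr (Arr (lift 0 A) (Arr (TVar 0) (TVar 0))) (TVar 0)))"

end

theory Submission
  imports Defs
begin

text \<open>
  Instantiating the quantifier of the result type by \<open>O\<close>, a closed normal inhabitant is a
  \<open>\<lambda>\<close>-abstraction whose body is built from variables of types such as \<open>A \<rightarrow> B \<rightarrow> O\<close>; its components
  are normal terms \<open>a : A\<close> typed in a context of such variables. These variables do not occur
  in \<open>a\<close>: replace \<open>O\<close> by \<open>\<bottom> \<rightarrow> \<bottom>\<close> and each saturated application of such a variable by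
  \<open>\<lambda>y. (y) y\<close>. The result is normal, closed and still of type \<open>A\<close>, because \<open>O\<close> is not in \<open>A\<close>. As \<open>A\<close>
  is an input type the result is typable without quantifier elimination, which \<open>(y) y\<close> is not.
  So \<open>a\<close> is closed, hence typable in \<open>F\<^sub>0\<close>, and the whole term is retyped with \<open>O\<close> generalized.
\<close>

subsection \<open>Types\<close>

lemma lift_lift: "i \<le> k \<Longrightarrow> lift i (lift k A) = lift (Suc k) (lift i A)"
  by (induction A arbitrary: i k) auto

lemma lift_subst: "i \<le> k \<Longrightarrow> lift i (subst k C A) = subst (Suc k) (lift i C) (lift i A)"
  by (induction A arbitrary: i k C) (auto simp: lift_lift)

lemma subst_lift [simp]: "subst k C (lift k A) = A"
  by (induction A arbitrary: k C) auto

lemma subst_subst: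
  "i \<le> k \<Longrightarrow> subst k C (subst i B A) = subst i (subst k C B) (subst (Suc k) (lift i C) A)"
  by (induction A arbitrary: i k C B) (auto simp: lift_lift lift_subst)

lemma size_lift [simp]: "size (lift k A) = size A"
  by (induction A arbitrary: k) auto

lemma fv_lift_less: "n < k \<Longrightarrow> n \<in> fv (lift k A) \<longleftrightarrow> n \<in> fv A"
  by (induction A arbitrary: n k) auto

lemma fv_subst_less: "n < k \<Longrightarrow> n \<in> fv A \<Longrightarrow> n \<in> fv (subst k C A)"
  by (induction A arbitrary: n k C) auto

lemma proper_lift [simp]: "proper (lift k A) = proper A"
  by (induction A arbitrary: k) (auto simp: fv_lift_less)

lemma proper_subst: "proper A \<Longrightarrow> proper C \<Longrightarrow> proper (subst k C A)"
  by (induction A arbitrary: k C) (auto simp: fv_subst_less)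

lemma lift_fv_less: "(\<And>n. n \<in> fv A \<Longrightarrow> n < k) \<Longrightarrow> lift k A = A"
proof (induction A arbitrary: k)
  case (All A)
  have "n < Suc k" if "n \<in> fv A" for n
    using All.prems[of "n - 1"] that by (cases n) auto
  then show ?case using All.IH by simp
qed auto

lemma lift_closed: "fv A = {} \<Longrightarrow> lift k A = A"
  by (rule lift_fv_less) simp

lemma subst_closed: "fv A = {} \<Longrightarrow> subst k C A = A"
  by (metis lift_closed subst_lift)

section \<open>Replacement of a type constant by a closed type\<close>

fun const_subst :: "nat \<Rightarrow> ty \<Rightarrow> ty \<Rightarrow> ty" where
  "const_subst c D (TVar n) = TVar n"
| "const_subst c D (TConst d) = (if d = c then D else TConst d)"
| "const_subst c D (Arr A B) = Arr (const_subst c D A) (const_subst c D B)"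
| "const_subst c D (All A) = All (const_subst c D A)"

text \<open>\<open>const_subst\<close> inserts \<open>D\<close> under quantifiers without lifting
  it, which is sound for closed \<open>D\<close>.\<close>

lemma const_subst_lift:
  "fv D = {} \<Longrightarrow> const_subst c D (lift k A) = lift k (const_subst c D A)"
  by (induction A arbitrary: k) (auto simp: lift_closed)

lemma const_subst_subst:
  "fv D = {} \<Longrightarrow>
    const_subst c D (subst k C A) = subst k (const_subst c D C) (const_subst c D A)"
  by (induction A arbitrary: k C) (auto simp: subst_closed const_subst_lift)

lemma fv_const_subst: "fv D = {} \<Longrightarrow> fv (const_subst c D A) = fv A"
  by (induction A) auto

lemma proper_const_subst:
  "fv D = {} \<Longrightarrow> proper D \<Longrightarrow> proper A \<Longrightarrow> proper (const_subst c D A)"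
  by (induction A) (auto simp: fv_const_subst)

lemma const_subst_fresh: "c \<notin> tconsts A \<Longrightarrow> const_subst c D A = A"
  by (induction A) auto

subsection \<open>Typing\<close>

fun tfv :: "lterm \<Rightarrow> nat set" where
  "tfv (Var x) = {x}"
| "tfv (Lam x t) = tfv t - {x}"
| "tfv (App t u) = tfv t \<union> tfv u"

lemma map_option_comp_upd: "map_option f \<circ> \<Gamma>(x \<mapsto> B) = (map_option f \<circ> \<Gamma>)(x \<mapsto> f B)"
  by auto

lemma map_option_subst_lift:
  "map_option (subst (Suc k) (lift 0 C)) \<circ> (map_option (lift 0) \<circ> \<Gamma>)
    = map_option (lift 0) \<circ> (map_option (subst k C) \<circ> \<Gamma>)"
  by (auto simp: fun_eq_iff option.map_comp o_def lift_subst)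

lemma has_type_cong_ctx:
  "has_type e \<Gamma> t A \<Longrightarrow> (\<And>x. x \<in> tfv t \<Longrightarrow> \<Gamma>' x = \<Gamma> x) \<Longrightarrow> has_type e \<Gamma>' t A"
proof (induction arbitrary: \<Gamma>' rule: has_type.induct)
  case (arr_e e \<Gamma> u B C v)
  then show ?case by (metis UnCI has_type.arr_e tfv.simps(3))
next
  case (all_e e \<Gamma> t A C)
  then show ?case by (blast intro: has_type.all_e)
qed (auto intro!: has_type.ax has_type.arr_i has_type.all_i)

lemma has_type_tfv: "has_type e \<Gamma> t A \<Longrightarrow> x \<in> tfv t \<Longrightarrow> \<Gamma> x \<noteq> None"
  by (induction rule: has_type.induct) (auto split: if_splits)

lemma has_type_closed: "has_type e Map.empty t A \<Longrightarrow> has_type e \<Gamma> t A"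
  using has_type_cong_ctx[of e Map.empty t A \<Gamma>] has_type_tfv[of e Map.empty t A] by blast

lemma has_type_subst:
  "has_type e \<Gamma> t A \<Longrightarrow> proper C \<Longrightarrow> has_type e (map_option (subst k C) \<circ> \<Gamma>) t (subst k C A)"
proof (induction arbitrary: k C rule: has_type.induct)
  case (ax \<Gamma> x A e)
  then show ?case by (auto intro!: has_type.ax simp: proper_subst)
next
  case (arr_i B e \<Gamma> x t D)
  have "has_type e (map_option (subst k C) \<circ> \<Gamma>(x \<mapsto> B)) t (subst k C D)"
    using arr_i by blast
  then have "has_type e ((map_option (subst k C) \<circ> \<Gamma>)(x \<mapsto> subst k C B)) t (subst k C D)"
    unfolding map_option_comp_upd .
  moreover have "proper (subst k C B)"
    using arr_i by (simp add: proper_subst)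
  ultimately show ?case
    unfolding subst.simps by (intro has_type.arr_i)
next
  case (arr_e e \<Gamma> u B D v)
  then show ?case by (metis has_type.arr_e subst.simps(3))
next
  case (all_i e \<Gamma> t A)
  have "has_type e (map_option (lift 0) \<circ> (map_option (subst k C) \<circ> \<Gamma>)) t
      (subst (Suc k) (lift 0 C) A)"
    using all_i.IH[of "lift 0 C" "Suc k"] all_i.prems
    unfolding map_option_subst_lift by (simp del: o_apply)
  moreover have "proper (subst k C (All A))"
    using all_i by (intro proper_subst)
  ultimately show ?case unfolding subst.simps by (rule has_type.all_i)
next
  case (all_e e \<Gamma> t A B)
  then have "has_type e (map_option (subst k C) \<circ> \<Gamma>) t (All (subst (Suc k) (lift 0 C) A))"
    by (simp del: o_apply)
  then have "has_type e (map_option (subst k C) \<circ> \<Gamma>) t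
      (subst 0 (subst k C B) (subst (Suc k) (lift 0 C) A))"
    using all_e by (intro has_type.all_e) (auto simp: proper_subst simp del: o_apply)
  then show ?case by (simp add: subst_subst del: o_apply)
qed

section \<open>Inversion for abstractions\<close>

text \<open>
  Typings of \<open>Lam x u\<close> that do not end with a quantifier elimination: closure under type
  substitution makes them exhaust all typings.
\<close>

inductive lam_typing :: "nat \<Rightarrow> lterm \<Rightarrow> ctx \<Rightarrow> ty \<Rightarrow> bool" for x u where
  arr: "has_type True (\<Gamma>(x \<mapsto> B)) u C \<Longrightarrow> lam_typing x u \<Gamma> (Arr B C)"
| all: "lam_typing x u (map_option (lift 0) \<circ> \<Gamma>) T \<Longrightarrow> lam_typing x u \<Gamma> (All T)"

lemma lam_typing_subst:
  "lam_typing x u \<Gamma> T \<Longrightarrow> proper C \<Longrightarrow> lam_typing x u (map_option (subst k C) \<circ> \<Gamma>) (subst k C T)"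
proof (induction arbitrary: k C rule: lam_typing.induct)
  case (arr \<Gamma> B D)
  then have "has_type True (map_option (subst k C) \<circ> \<Gamma>(x \<mapsto> B)) u (subst k C D)"
    by (intro has_type_subst)
  then show ?case
    unfolding map_option_comp_upd subst.simps by (rule lam_typing.arr)
next
  case (all \<Gamma> T)
  then show ?case
    using all.IH[of "lift 0 C" "Suc k"]
    unfolding map_option_subst_lift subst.simps by (simp add: lam_typing.all del: o_apply)
qed

text \<open>Generalizing and then instantiating is a detour: a \<open>lam_typing\<close> at
  \<open>All A\<close> comes from one at \<open>A\<close> in the lifted context, and substituting
  \<open>C\<close> for index 0 in it undoes the lifting.\<close>

lemma has_type_Lam:
  assumes "has_type True \<Gamma> (Lam x u) T"
  shows "lam_typing x u \<Gamma> T"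
  using assms
proof (induction True \<Gamma> "Lam x u" T rule: has_type.induct)
  case (all_e \<Gamma> A C)
  from all_e(3) have "lam_typing x u (map_option (lift 0) \<circ> \<Gamma>) A"
    by cases auto
  then have "lam_typing x u (map_option (subst 0 C) \<circ> (map_option (lift 0) \<circ> \<Gamma>)) (subst 0 C A)"
    using all_e by (intro lam_typing_subst)
  moreover have "map_option (subst 0 C) \<circ> (map_option (lift 0) \<circ> \<Gamma>) = \<Gamma>"
    by (auto simp: fun_eq_iff option.map_comp o_def option.map_ident)
  ultimately show ?case by simp
qed (auto intro: lam_typing.intros)

lemma has_type_Lam_Arr:
  "has_type True \<Gamma> (Lam x u) (Arr B C) \<Longrightarrow> has_type True (\<Gamma>(x \<mapsto> B)) u C"
  by (drule has_type_Lam) (auto elim: lam_typing.cases)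

lemma has_type_Lam_TConst: "\<not> has_type True \<Gamma> (Lam x u) (TConst c)"
  by (auto dest!: has_type_Lam elim: lam_typing.cases)

section \<open>Neutral terms over contexts of closed types\<close>

lemma map_option_lift_closed:
  assumes "\<And>x T. \<Gamma> x = Some T \<Longrightarrow> fv T = {}"
  shows "map_option (lift k) \<circ> \<Gamma> = \<Gamma>"
proof
  show "(map_option (lift k) \<circ> \<Gamma>) x = \<Gamma> x" for x
    using assms by (cases "\<Gamma> x") (auto simp: lift_closed)
qed

text \<open>
  Properness is essential here: a closed type cannot be generalized, so a neutral term over
  such a context has no other type than the one read off from its head variable.
\<close>

lemma has_type_neutral:
  assumes "has_type True \<Gamma> v T" "normal v" "\<not> is_lam v" "ran \<Gamma> \<subseteq> S"
    and closed: "\<And>T. T \<in> S \<Longrightarrow> fv T = {}"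
    and not_All: "\<And>T. All T \<notin> S"
    and target: "\<And>P Q. Arr P Q \<in> S \<Longrightarrow> Q \<in> S"
  shows "T \<in> S \<and> (case v of Var x \<Rightarrow> \<Gamma> x = Some T
    | App u w \<Rightarrow> (\<exists>P. has_type True \<Gamma> u (Arr P T) \<and> has_type True \<Gamma> w P \<and> Arr P T \<in> S)
    | _ \<Rightarrow> False)"
  using assms(1-4)
proof (induction True \<Gamma> v T rule: has_type.induct)
  case (ax \<Gamma> x A)
  then show ?case by (auto intro: ranI)
next
  case (arr_e \<Gamma> u B C v)
  then have "Arr B C \<in> S" by simp
  then show ?case using arr_e target by auto
next
  case (all_i \<Gamma> t A)
  \<comment> \<open>Lifting leaves this context alone, so induction puts \<open>A\<close> into
    \<open>S\<close>; then \<open>A\<close> is closed, contrary to the properness of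
    \<open>All A\<close>.\<close>
  have "map_option (lift 0) \<circ> \<Gamma> = \<Gamma>"
    using all_i closed by (intro map_option_lift_closed) (auto intro: ranI)
  then have "A \<in> S" using all_i by simp
  then show ?case using all_i closed by auto
next
  case (all_e \<Gamma> t A C)
  then show ?case using not_All by auto
qed auto

lemma closed_normal_is_lam:
  assumes "has_type True Map.empty t T" "normal t"
  shows "is_lam t"
proof (rule ccontr)
  assume "\<not> is_lam t"
  then show False using has_type_neutral[OF assms, of "{}"] by auto
qed

subsection \<open>Self-application\<close>

text \<open>The trace left by an eliminated variable, by which typability without quantifier
  elimination is refuted.\<close>

fun self_app :: "lterm \<Rightarrow> bool" where
  "self_app (Var x) = False"
| "self_app (Lam x t) = self_app t"
| "self_app (App t u) \<longleftrightarrow> (\<exists>y. t = Var y \<and> u = Var y) \<or> self_app t \<or> self_app u"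

text \<open>Without quantifier elimination the type of a variable can only grow from the one in the
  context: generalization adds a quantifier, and lifting preserves size.\<close>

lemma F0_Var_size:
  "has_type False \<Gamma> (Var y) T \<Longrightarrow> \<exists>A. \<Gamma> y = Some A \<and> size A \<le> size T"
  by (induction False \<Gamma> "Var y" T rule: has_type.induct) auto

text \<open>In a self-application of \<open>y\<close> the function gets its type
  \<open>Arr B C\<close> straight from the context, while the argument would need this type to be no
  larger than \<open>B\<close>.\<close>

lemma F0_no_self_app: "has_type False \<Gamma> t T \<Longrightarrow> \<not> self_app t"
proof (induction False \<Gamma> t T rule: has_type.induct)
  case (arr_e \<Gamma> u B C v)
  have "\<not> (u = Var y \<and> v = Var y)" for y
  proof
    assume eq: "u = Var y \<and> v = Var y"
    then have "has_type False \<Gamma> (Var y) (Arr B C)" using arr_e by simp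
    then have "\<Gamma> y = Some (Arr B C)" by cases auto
    then show False using F0_Var_size[of \<Gamma> y B] arr_e eq by auto
  qed
  then show ?case using arr_e by auto
qed auto

section \<open>Closed terms that replace the eliminated variables and their applications\<close>

definition delta :: lterm where "delta = Lam 0 (App (Var 0) (Var 0))"

definition delta_ty :: ty where "delta_ty = Arr (All (TVar 0)) (All (TVar 0))"

lemma delta_ty_closed: "fv delta_ty = {}" and delta_ty_proper: "proper delta_ty"
  by (auto simp: delta_ty_def)

lemma has_type_delta: "has_type True \<Gamma> delta delta_ty"
proof -
  let ?bot = "All (TVar 0)"
  let ?G = "\<Gamma>(0 \<mapsto> ?bot)"
  have v: "has_type True ?G (Var 0) ?bot" by (auto intro: has_type.ax)
  then have "has_type True ?G (Var 0) (subst 0 (Arr ?bot ?bot) (TVar 0))"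
    by (intro has_type.all_e) auto
  then have "has_type True ?G (App (Var 0) (Var 0)) ?bot"
    using v by (auto intro: has_type.arr_e)
  then show ?thesis
    unfolding delta_def delta_ty_def by (intro has_type.arr_i) auto
qed

text \<open>Stands for a term that awaits \<open>n\<close> arguments before reaching type
  \<open>O\<close>, once \<open>O\<close> has become \<open>delta_ty\<close>. Reusing the name 0 is
  harmless because \<open>delta\<close> is closed.\<close>

fun lams :: "nat \<Rightarrow> lterm" where
  "lams 0 = delta"
| "lams (Suc n) = Lam 0 (lams n)"

lemma normal_lams: "normal (lams n)"
  by (induction n) (auto simp: delta_def)

lemma self_app_lams: "self_app (lams n)"
  by (induction n) (auto simp: delta_def)

text \<open>Types of the variables to be eliminated and of their applications. The domains are
  closed so that such a type cannot be generalized.\<close>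

inductive O_chain :: "nat \<Rightarrow> ty \<Rightarrow> bool" where
  "O_chain 0 TO"
| "fv P = {} \<Longrightarrow> proper P \<Longrightarrow> O_chain n Q \<Longrightarrow> O_chain (Suc n) (Arr P Q)"

lemma O_chain_closed: "O_chain n T \<Longrightarrow> fv T = {}"
  by (induction rule: O_chain.induct) (auto simp: TO_def)

lemma O_chain_not_All: "\<not> O_chain n (All T)"
  by (auto simp: TO_def elim: O_chain.cases)

lemma O_chain_Arr: "O_chain n (Arr P Q) \<Longrightarrow> n > 0 \<and> O_chain (n - 1) Q"
  by (auto simp: TO_def elim: O_chain.cases)

lemma has_type_lams: "O_chain n T \<Longrightarrow> has_type True \<Gamma> (lams n) (const_subst 0 delta_ty T)"
proof (induction arbitrary: \<Gamma> rule: O_chain.induct)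
  case 1
  then show ?case by (simp add: TO_def has_type_delta)
next
  case (2 P n Q)
  then show ?case
    by (simp add: has_type.arr_i proper_const_subst delta_ty_closed delta_ty_proper)
qed

section \<open>Elimination of variables of chain type\<close>

text \<open>
  The map \<open>\<rho>\<close> gives the arity of the variables to be eliminated; \<open>head_arity\<close> is the number of
  arguments still missing in an application headed by such a variable (the truncated
  subtraction is never reached by typed terms).
\<close>

fun head_arity :: "(nat \<Rightarrow> nat option) \<Rightarrow> lterm \<Rightarrow> nat option" where
  "head_arity \<rho> (Var x) = \<rho> x"
| "head_arity \<rho> (Lam x t) = None"
| "head_arity \<rho> (App t u) = map_option (\<lambda>n. n - 1) (head_arity \<rho> t)"

text \<open>Substituting \<open>lams n\<close> for a head variable would create redexes, so an
  application headed by such a variable is replaced as a whole and its arguments are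
  dropped.\<close>

fun elim_vars :: "(nat \<Rightarrow> nat option) \<Rightarrow> lterm \<Rightarrow> lterm" where
  "elim_vars \<rho> (Var x) = (case \<rho> x of None \<Rightarrow> Var x | Some n \<Rightarrow> lams n)"
| "elim_vars \<rho> (Lam x t) = Lam x (elim_vars (\<rho>(x := None)) t)"
| "elim_vars \<rho> (App t u) = (case head_arity \<rho> t of
     None \<Rightarrow> App (elim_vars \<rho> t) (elim_vars \<rho> u) | Some n \<Rightarrow> lams (n - 1))"

text \<open>New abstractions arise only as some \<open>lams n\<close>, and these replace only terms
  that have a head arity.\<close>

lemma is_lam_elim_vars:
  "\<not> is_lam t \<Longrightarrow> head_arity \<rho> t = None \<Longrightarrow> \<not> is_lam (elim_vars \<rho> t)"
  by (cases t) auto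

lemma normal_elim_vars: "normal t \<Longrightarrow> normal (elim_vars \<rho> t)"
  by (induction t arbitrary: \<rho>) (auto simp: normal_lams is_lam_elim_vars split: option.split)

text \<open>A free occurrence of \<open>x\<close> is either replaced by some \<open>lams n\<close>
  or dropped within an application that is; both leave a \<open>delta\<close> behind.\<close>

lemma self_app_elim_vars:
  "x \<in> tfv t \<Longrightarrow> \<rho> x \<noteq> None \<Longrightarrow> self_app (elim_vars \<rho> t)"
  by (induction t arbitrary: \<rho>) (auto simp: self_app_lams split: option.split)

text \<open>Chain types are closed and never quantified, so no quantifier rule can change the type
  read off along the applications.\<close>

lemma has_type_head_arity:
  assumes "has_type True \<Gamma> t T" "head_arity \<rho> t = Some n"
    and "\<And>x n. \<rho> x = Some n \<Longrightarrow> \<exists>T. \<Gamma> x = Some T \<and> O_chain n T"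
  shows "O_chain n T"
  using assms
proof (induction True \<Gamma> t T arbitrary: n rule: has_type.induct)
  case (ax \<Gamma> x A)
  then show ?case by fastforce
next
  case (arr_e \<Gamma> u B C v)
  then obtain m where m: "head_arity \<rho> u = Some m" "n = m - 1" by auto
  then have "O_chain m (Arr B C)" using arr_e by blast
  then show ?case using O_chain_Arr m by blast
next
  case (all_i \<Gamma> t A)
  have "\<exists>T. (map_option (lift 0) \<circ> \<Gamma>) x = Some T \<and> O_chain n T" if "\<rho> x = Some n" for x n
    using all_i.prems(2)[OF that] by (auto simp: lift_closed O_chain_closed)
  then have "O_chain n A" using all_i.hyps(2) all_i.prems(1) by blast
  then show ?case using all_i O_chain_closed by auto
next
  case (all_e \<Gamma> t A C)
  then show ?case using O_chain_not_All by blast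
qed auto

text \<open>\<open>\<Delta>\<close> is arbitrary on the eliminated variables, since their free
  occurrences vanish; this is what allows passing to the empty context.\<close>

lemma has_type_elim_vars:
  assumes "has_type True \<Gamma> t T"
    and "\<And>x n. \<rho> x = Some n \<Longrightarrow> \<exists>T. \<Gamma> x = Some T \<and> O_chain n T"
    and "\<And>x. \<rho> x = None \<Longrightarrow> \<Delta> x = map_option (const_subst 0 delta_ty) (\<Gamma> x)"
  shows "has_type True \<Delta> (elim_vars \<rho> t) (const_subst 0 delta_ty T)"
  using assms
proof (induction True \<Gamma> t T arbitrary: \<rho> \<Delta> rule: has_type.induct)
  case (ax \<Gamma> x A)
  show ?case
  proof (cases "\<rho> x")
    case None
    then show ?thesis using ax
      by (auto intro!: has_type.ax simp: proper_const_subst delta_ty_closed delta_ty_proper)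
  next
    case (Some n)
    then have "O_chain n A" using ax by fastforce
    then show ?thesis using Some by (simp add: has_type_lams)
  qed
next
  case (arr_i B \<Gamma> x t C)
  have "has_type True (\<Delta>(x \<mapsto> const_subst 0 delta_ty B)) (elim_vars (\<rho>(x := None)) t)
      (const_subst 0 delta_ty C)"
    by (rule arr_i.hyps(3)) (use arr_i.prems in \<open>auto split: if_splits\<close>)
  then show ?case using arr_i.hyps(1)
    by (auto intro: has_type.arr_i simp: proper_const_subst delta_ty_closed delta_ty_proper)
next
  case (arr_e \<Gamma> u B C v)
  show ?case
  proof (cases "head_arity \<rho> u")
    case None
    have "has_type True \<Delta> (elim_vars \<rho> u) (const_subst 0 delta_ty (Arr B C))"
      using arr_e by blast
    moreover have "has_type True \<Delta> (elim_vars \<rho> v) (const_subst 0 delta_ty B)"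
      using arr_e by blast
    ultimately show ?thesis using None by (auto intro: has_type.arr_e)
  next
    case (Some n)
    then have "O_chain n (Arr B C)"
      using has_type_head_arity arr_e.hyps(1) arr_e.prems(1) by blast
    then have "O_chain (n - 1) C" using O_chain_Arr by blast
    then show ?thesis using Some has_type_lams by simp
  qed
next
  case (all_i \<Gamma> t A)
  have "has_type True (map_option (lift 0) \<circ> \<Delta>) (elim_vars \<rho> t) (const_subst 0 delta_ty A)"
  proof (rule all_i.hyps(2))
    show "\<exists>T. (map_option (lift 0) \<circ> \<Gamma>) x = Some T \<and> O_chain n T" if "\<rho> x = Some n" for x n
      using all_i.prems(1)[OF that] by (auto simp: lift_closed O_chain_closed)
    show "(map_option (lift 0) \<circ> \<Delta>) x
        = map_option (const_subst 0 delta_ty) ((map_option (lift 0) \<circ> \<Gamma>) x)" if "\<rho> x = None" for x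
      using all_i.prems(2)[OF that]
      by (simp add: option.map_comp o_def const_subst_lift delta_ty_closed)
  qed
  moreover have "proper (const_subst 0 delta_ty (All A))"
    using all_i by (intro proper_const_subst delta_ty_closed delta_ty_proper)
  ultimately show ?case by (auto intro: has_type.all_i)
next
  case (all_e \<Gamma> t A C)
  have "has_type True \<Delta> (elim_vars \<rho> t) (All (const_subst 0 delta_ty A))"
    using all_e by force
  then have "has_type True \<Delta> (elim_vars \<rho> t)
      (subst 0 (const_subst 0 delta_ty C) (const_subst 0 delta_ty A))"
    using all_e
    by (intro has_type.all_e) (auto simp: proper_const_subst delta_ty_closed delta_ty_proper)
  then show ?case by (simp add: const_subst_subst delta_ty_closed)
qed

section \<open>Components are closed and typable without quantifier elimination\<close>

lemma input_type_component:
  assumes A: "input_type A" "\<not> contains_const A TO"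
    and a: "has_type True \<Gamma> a A" "normal a"
    and \<Gamma>: "\<And>T. T \<in> ran \<Gamma> \<Longrightarrow> \<exists>n. O_chain n T"
  shows "has_type False \<Delta> a A"
proof -
  \<comment> \<open>Every variable of the context is eliminated; \<open>SOME\<close> merely picks a
    length for its chain.\<close>
  define \<rho> where "\<rho> = (\<lambda>x. map_option (\<lambda>T. SOME n. O_chain n T) (\<Gamma> x))"
  have "O_chain (SOME n. O_chain n T) T" if "\<Gamma> x = Some T" for x T
    using \<Gamma>[of T] that by (meson ranI someI_ex)
  then have "has_type True Map.empty (elim_vars \<rho> a) (const_subst 0 delta_ty A)"
    by (intro has_type_elim_vars[OF a(1)]) (auto simp: \<rho>_def)
  moreover have "const_subst 0 delta_ty A = A"
    using A(2) by (auto simp: contains_const_def TO_def const_subst_fresh)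
  ultimately have "has_type False Map.empty (elim_vars \<rho> a) A"
    using A(1) normal_elim_vars[OF a(2)] unfolding input_type_def by auto
  then have "\<not> self_app (elim_vars \<rho> a)" by (rule F0_no_self_app)
  \<comment> \<open>A free variable of \<open>a\<close> has a type in \<open>\<Gamma>\<close>, hence
    is eliminated and would leave a self-application.\<close>
  then have "x \<notin> tfv a" for x
    using self_app_elim_vars[of x a \<rho>] has_type_tfv[OF a(1), of x] by (auto simp: \<rho>_def)
  then have "has_type True Map.empty a A"
    by (intro has_type_cong_ctx[OF a(1)]) auto
  then show ?thesis
    using A(1) a(2) has_type_closed unfolding input_type_def by blast
qed

subsection \<open>Conjunctions, disjunctions and lists\<close>

lemma input_type_simps:
  assumes "input_type A"
  shows "fv A = {}" "proper A" "lift k A = A" "subst k C A = A"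
  using assms by (auto simp: input_type_def closed_ty_def lift_closed subst_closed)

lemma has_type_inst_TO:
  "has_type True \<Gamma> t (All T) \<Longrightarrow> has_type True \<Gamma> t (subst 0 TO T)"
  by (rule has_type.all_e) (auto simp: TO_def)

text \<open>Normal closed inhabitants are the pairs \<open>Lam x (App (App (Var x) a) b)\<close>,
  which inversion takes apart from the outside.\<close>

lemma input_type_tconj:
  assumes A: "input_type A" "\<not> contains_const A TO"
    and B: "input_type B" "\<not> contains_const B TO"
  shows "input_type (tconj A B)"
  unfolding input_type_def
proof (intro conjI allI impI)
  note simps = input_type_simps[OF A(1)] input_type_simps[OF B(1)]
  show "closed_ty (tconj A B)" "proper (tconj A B)"
    by (auto simp: tconj_def closed_ty_def simps)
  fix t assume t: "normal t" "has_type True Map.empty t (tconj A B)"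
  then obtain x v where v: "t = Lam x v" "normal v"
    using closed_normal_is_lam by (metis is_lam.elims(2) normal.simps(2))
  let ?G = "[x \<mapsto> Arr A (Arr B TO)]"
  have "has_type True Map.empty t (Arr (Arr A (Arr B TO)) TO)"
    using has_type_inst_TO t(2) by (fastforce simp: tconj_def simps)
  then have vt: "has_type True ?G v TO"
    using has_type_Lam_Arr v by blast
  \<comment> \<open>The possible types of neutral terms: the one in the context and, for
    applications, its successive targets.\<close>
  let ?S = "{Arr A (Arr B TO), Arr B TO, TO}"
  have neutral: "T \<in> ?S \<and> (case w of Var x \<Rightarrow> ?G x = Some T
    | App u w \<Rightarrow> (\<exists>P. has_type True ?G u (Arr P T) \<and> has_type True ?G w P \<and> Arr P T \<in> ?S)
    | _ \<Rightarrow> False)" if "has_type True ?G w T" "normal w" "\<not> is_lam w" for w T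
    by (rule has_type_neutral[OF that]) (auto simp: TO_def simps)
  have "\<not> is_lam v" using vt has_type_Lam_TConst by (cases v) (auto simp: TO_def)
  with neutral[OF vt v(2)] obtain u b where ub: "v = App u b" "has_type True ?G u (Arr B TO)"
      "has_type True ?G b B"
    by (auto split: lterm.splits if_splits simp: TO_def)
  with v have u: "normal u" "\<not> is_lam u" "normal b" by auto
  with neutral[OF ub(2)] obtain w a where wa: "u = App w a"
      "has_type True ?G w (Arr A (Arr B TO))" "has_type True ?G a A"
    by (auto split: lterm.splits if_splits simp: TO_def)
  with u have w: "normal w" "\<not> is_lam w" "normal a" by auto
  with neutral[OF wa(2)] have wx: "w = Var x"
    by (auto split: lterm.splits if_splits simp: TO_def)
  have chain: "\<exists>n. O_chain n T" if "T \<in> ran ?G" for T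
    using that by (auto intro!: exI[of _ "Suc (Suc 0)"] O_chain.intros simp: simps)
  \<comment> \<open>\<open>O\<close> gives way to the type variable that is generalized at the end;
    \<open>input_type_component\<close> leaves the choice of the new context free.\<close>
  let ?H = "[x \<mapsto> Arr A (Arr B (TVar 0))]"
  have "has_type False ?H a A" "has_type False ?H b B"
    using input_type_component[OF A wa(3) w(3)] input_type_component[OF B ub(3) u(3)] chain
    by blast+
  moreover have "has_type False ?H (Var x) (Arr A (Arr B (TVar 0)))"
    by (auto intro: has_type.ax simp: simps)
  ultimately have "has_type False ?H v (TVar 0)"
    unfolding ub(1) wa(1) wx by (blast intro: has_type.arr_e)
  then show "has_type False Map.empty t (tconj A B)"
    unfolding v(1) tconj_def
    by (intro has_type.all_i has_type.arr_i) (auto simp: simps)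
qed

text \<open>Normal closed inhabitants are the injections
  \<open>Lam x (Lam y (App (Var z) a))\<close>, where \<open>z\<close> is \<open>x\<close> or
  \<open>y\<close>.\<close>

lemma input_type_tdisj:
  assumes A: "input_type A" "\<not> contains_const A TO"
    and B: "input_type B" "\<not> contains_const B TO"
  shows "input_type (tdisj A B)"
  unfolding input_type_def
proof (intro conjI allI impI)
  note simps = input_type_simps[OF A(1)] input_type_simps[OF B(1)]
  show "closed_ty (tdisj A B)" "proper (tdisj A B)"
    by (auto simp: tdisj_def closed_ty_def simps)
  fix t assume t: "normal t" "has_type True Map.empty t (tdisj A B)"
  then obtain x u where u: "t = Lam x u" "normal u"
    using closed_normal_is_lam by (metis is_lam.elims(2) normal.simps(2))
  have "has_type True Map.empty t (Arr (Arr A TO) (Arr (Arr B TO) TO))"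
    using has_type_inst_TO t(2) by (fastforce simp: tdisj_def simps)
  then have ut: "has_type True [x \<mapsto> Arr A TO] u (Arr (Arr B TO) TO)"
    using has_type_Lam_Arr u by blast
  \<comment> \<open>A neutral \<open>u\<close> would have a context type or its target as type. This
    forces \<open>A\<close> to be \<open>Arr B TO\<close>, which contains \<open>O\<close>.\<close>
  have "is_lam u"
  proof (rule ccontr)
    assume "\<not> is_lam u"
    have "Arr (Arr B TO) TO \<in> {Arr A TO, TO}"
      by (rule conjunct1[OF has_type_neutral[OF ut u(2) \<open>\<not> is_lam u\<close>]])
        (auto simp: simps TO_def)
    then have "A = Arr B TO" by (simp add: TO_def)
    then show False using A(2) by (auto simp: contains_const_def TO_def)
  qed
  with u obtain y v where v: "u = Lam y v" "normal v"
    by (metis is_lam.elims(2) normal.simps(2))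
  let ?G = "[x \<mapsto> Arr A TO, y \<mapsto> Arr B TO]"
  have vt: "has_type True ?G v TO"
    using has_type_Lam_Arr ut v by blast
  let ?S = "{Arr A TO, Arr B TO, TO}"
  \<comment> \<open>If \<open>x\<close> and \<open>y\<close> coincide, the second binding hides the
    first; hence only an inclusion.\<close>
  have ran: "ran ?G \<subseteq> ?S"
    by (auto simp: ran_def)
  have neutral: "T \<in> ?S \<and> (case w of Var x \<Rightarrow> ?G x = Some T
    | App u w \<Rightarrow> (\<exists>P. has_type True ?G u (Arr P T) \<and> has_type True ?G w P \<and> Arr P T \<in> ?S)
    | _ \<Rightarrow> False)" if "has_type True ?G w T" "normal w" "\<not> is_lam w" for w T
    by (rule has_type_neutral[OF that ran]) (auto simp: TO_def simps)
  have chain: "\<exists>n. O_chain n T" if "T \<in> ran ?G" for T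
    using that ran by (auto 0 4 intro: O_chain.intros simp: simps)
  have "\<not> is_lam v" using vt has_type_Lam_TConst by (cases v) (auto simp: TO_def)
  with neutral[OF vt v(2)] obtain w a P where wa: "v = App w a" "has_type True ?G w (Arr P TO)"
      "has_type True ?G a P" and P: "P = A \<or> P = B"
    by (auto split: lterm.splits if_splits simp: TO_def)
  with v have w: "normal w" "\<not> is_lam w" "normal a" by auto
  with neutral[OF wa(2)] obtain z where z: "w = Var z" "?G z = Some (Arr P TO)"
    by (auto split: lterm.splits simp: TO_def)
  let ?H = "[x \<mapsto> Arr A (TVar 0), y \<mapsto> Arr B (TVar 0)]"
  have "has_type False ?H a P"
    using P input_type_component[OF A _ w(3)] input_type_component[OF B _ w(3)] wa(3) chain
    by blast
  moreover have "has_type False ?H (Var z) (Arr P (TVar 0))"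
    using z P simps(2,6) by (auto intro!: has_type.ax split: if_splits)
  ultimately have "has_type False ?H v (TVar 0)"
    unfolding wa(1) z(1) by (blast intro: has_type.arr_e)
  then show "has_type False Map.empty t (tdisj A B)"
    unfolding u(1) v(1) tdisj_def
    by (intro has_type.all_i has_type.arr_i) (auto simp: simps)
qed

text \<open>Normal closed inhabitants code lists: under the two abstractions stands either
  \<open>x\<close>, the empty list, or \<open>y\<close> applied to an element and to a tail of the
  same form.\<close>

lemma input_type_tlist:
  assumes A: "input_type A" "\<not> contains_const A TO"
  shows "input_type (tlist A)"
  unfolding input_type_def
proof (intro conjI allI impI)
  note simps = input_type_simps[OF A(1)]
  show "closed_ty (tlist A)" "proper (tlist A)"
    by (auto simp: tlist_def closed_ty_def simps)
  fix t assume t: "normal t" "has_type True Map.empty t (tlist A)"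
  then obtain x u where u: "t = Lam x u" "normal u"
    using closed_normal_is_lam by (metis is_lam.elims(2) normal.simps(2))
  have "has_type True Map.empty t (Arr TO (Arr (Arr A (Arr TO TO)) TO))"
    using has_type_inst_TO t(2) by (fastforce simp: tlist_def simps)
  then have ut: "has_type True [x \<mapsto> TO] u (Arr (Arr A (Arr TO TO)) TO)"
    using has_type_Lam_Arr u by blast
  have "is_lam u"
  proof (rule ccontr)
    assume "\<not> is_lam u"
    have "Arr (Arr A (Arr TO TO)) TO \<in> {TO}"
      by (rule conjunct1[OF has_type_neutral[OF ut u(2) \<open>\<not> is_lam u\<close>]])
        (auto simp: TO_def)
    then show False by (simp add: TO_def)
  qed
  with u obtain y v where v: "u = Lam y v" "normal v"
    by (metis is_lam.elims(2) normal.simps(2))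
  let ?G = "[x \<mapsto> TO, y \<mapsto> Arr A (Arr TO TO)]"
  have vt: "has_type True ?G v TO"
    using has_type_Lam_Arr ut v by blast
  let ?S = "{Arr A (Arr TO TO), Arr TO TO, TO}"
  have ran: "ran ?G \<subseteq> {Arr A (Arr TO TO), TO}"
    by (auto simp: ran_def)
  have neutral: "T \<in> ?S \<and> (case w of Var x \<Rightarrow> ?G x = Some T
    | App u w \<Rightarrow> (\<exists>P. has_type True ?G u (Arr P T) \<and> has_type True ?G w P \<and> Arr P T \<in> ?S)
    | _ \<Rightarrow> False)" if "has_type True ?G w T" "normal w" "\<not> is_lam w" for w T
    by (rule has_type_neutral[OF that]) (use ran in \<open>auto simp: TO_def simps\<close>)
  have chain: "\<exists>n. O_chain n T" if "T \<in> ran ?G" for T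
  proof -
    have "fv TO = {}" "proper TO" by (auto simp: TO_def)
    then have "O_chain (Suc (Suc 0)) (Arr A (Arr TO TO))"
      by (intro O_chain.intros) (auto simp: simps)
    then show ?thesis using that ran O_chain.intros(1) by auto
  qed
  let ?H = "[x \<mapsto> TVar 0, y \<mapsto> Arr A (Arr (TVar 0) (TVar 0))]"
  \<comment> \<open>The tail again has type \<open>TO\<close> in \<open>?G\<close>, so the induction
    runs along the list; the elements are covered by \<open>input_type_component\<close>.\<close>
  have "has_type False ?H v (TVar 0)"
    using vt v(2)
  proof (induction "size v" arbitrary: v rule: less_induct)
    case (less v)
    have "\<not> is_lam v" using less.prems has_type_Lam_TConst by (cases v) (auto simp: TO_def)
    note v_neutral = neutral[OF less.prems this]
    show ?case
    proof (cases v)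
      case (Var z)
      \<comment> \<open>A variable of type \<open>TO\<close> in \<open>?G\<close> can only be
        \<open>x\<close>, the end of the list.\<close>
      then show ?thesis using v_neutral
        by (auto intro!: has_type.ax simp: TO_def split: if_splits)
    next
      case (Lam z w)
      then show ?thesis using \<open>\<not> is_lam v\<close> by simp
    next
      case (App w l)
      with v_neutral have wl: "has_type True ?G w (Arr TO TO)" "has_type True ?G l TO"
        by (auto simp: TO_def)
      from App less.prems have w: "normal w" "\<not> is_lam w" "normal l" by auto
      with neutral[OF wl(1)] obtain w' a where wa: "w = App w' a"
          "has_type True ?G w' (Arr A (Arr TO TO))" "has_type True ?G a A"
        by (auto split: lterm.splits if_splits simp: TO_def)
      with w have w': "normal w'" "\<not> is_lam w'" "normal a" by auto
      with neutral[OF wa(2)] have w'y: "w' = Var y"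
        by (auto split: lterm.splits if_splits simp: TO_def)
      have "has_type False ?H a A"
        using input_type_component[OF A wa(3) w'(3)] chain by blast
      moreover have "has_type False ?H l (TVar 0)"
        using less.hyps[of l] App wl w by simp
      moreover have "has_type False ?H (Var y) (Arr A (Arr (TVar 0) (TVar 0)))"
        by (auto intro: has_type.ax simp: simps)
      ultimately show ?thesis
        unfolding App wa(1) w'y by (blast intro: has_type.arr_e)
    qed
  qed
  then show "has_type False Map.empty t (tlist A)"
    unfolding u(1) v(1) tlist_def
    by (intro has_type.all_i has_type.arr_i) (auto simp: simps)
qed

theorem theorem2p2p9:
  assumes "input_type A" and "input_type B"
    and "\<not> contains_const A TO" and "\<not> contains_const B TO"
  shows "input_type (tconj A B) \<and> input_type (tdisj A B) \<and> input_type (tlist A)"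
  using assms input_type_tconj input_type_tdisj input_type_tlist by blast

end
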